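(* Let $N\ge 3$ and let $W_{N+1}$ be the wheel graph with rim vertices $v_1,\ldots,v_N$ and central vertex $c$. Let $1\le r\le N$, let $R=\{v_{a_1},v_{a_2},\ldots,v_{a_r}\}$ with $1\le a_1<a_2<\cdots<a_r\le N$, and define $d_i=a_{i+1}-a_i$ for $1\le i\le r-1$ and $d_r=a_1+N-a_r$. Then the number $\mathcal F_{W_{N+1}}(R)$ of rooted spanning forests of $W_{N+1}$ with root set $R$ is $$\mathcal F_{W_{N+1}}(R)=\left(\prod_{i=1}^{r}F_{2d_i}\right)\left(\sum_{i=1}^{r}\frac{L_{2d_i}-2}{F_{2d_i}}\right)=\sum_{i=1}^{r}\left(L_{2d_i}-2\right)\prod_{\substack{1\le j\le r\\ j\ne i}}F_{2d_j}.$$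
   Context: The wheel graph $W_{N+1}$ ($N\ge3$) has vertex set $\{c,v_1,\ldots,v_N\}$ and edges $\{v_i,v_{i+1}\}$ (indices modulo $N$) and $\{c,v_i\}$ for $1\le i\le N$. For a finite connected graph $G$ and $\varnothing\ne R\subseteq V(G)$, a rooted spanning forest of $G$ with root set $R$ is a spanning forest (an acyclic subgraph containing all vertices of $G$) in which each connected component contains exactly one vertex of $R$; $\mathcal F_G(R)$ denotes the number of such forests. Fibonacci numbers: $F_0=0$, $F_1=1$, $F_{n+2}=F_{n+1}+F_n$. Lucas numbers: $L_0=2$, $L_1=1$, $L_{n+2}=L_{n+1}+L_n$. *)

theory Defs
  imports Complex_Main "HOL-Number_Theory.Fib"
begin

section \<open>Finite simple graphs\<close>

text \<open>Undirected edges are two-element sets of vertices.\<close>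

datatype 'a ugraph = UGraph (uverts: "'a set") (uedges: "'a set set")

definition fin_simple_ugraph :: "'a ugraph \<Rightarrow> bool" where
  "fin_simple_ugraph G \<longleftrightarrow>
     finite (uverts G) \<and>
     (\<forall>e\<in>uedges G. \<exists>u\<in>uverts G. \<exists>v\<in>uverts G. u \<noteq> v \<and> e = {u, v})"

definition is_subgraph :: "'a ugraph \<Rightarrow> 'a ugraph \<Rightarrow> bool" where
  "is_subgraph H G \<longleftrightarrow>
     fin_simple_ugraph H \<and> uverts H \<subseteq> uverts G \<and> uedges H \<subseteq> uedges G"

definition ureach :: "'a ugraph \<Rightarrow> ('a \<times> 'a) set" where
  "ureach G = {(u, v). u \<in> uverts G \<and> v \<in> uverts G \<and> (u, v) \<in> {(x, y). {x, y} \<in> uedges G}\<^sup>*}"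

text \<open>Components are represented by their vertex sets.\<close>

definition ucomponents :: "'a ugraph \<Rightarrow> 'a set set" where
  "ucomponents G = uverts G // ureach G"

definition uconnected :: "'a ugraph \<Rightarrow> bool" where
  "uconnected G \<longleftrightarrow> (\<exists>C. ucomponents G = {C})"

text \<open>A cycle is given by its list of vertices, without repeating the first one at the end.\<close>

definition ucycle :: "'a ugraph \<Rightarrow> 'a list \<Rightarrow> bool" where
  "ucycle G p \<longleftrightarrow>
     3 \<le> length p \<and> distinct p \<and>
     (\<forall>i<length p. {p ! i, p ! (Suc i mod length p)} \<in> uedges G)"

definition uacyclic :: "'a ugraph \<Rightarrow> bool" where
  "uacyclic G \<longleftrightarrow> (\<nexists>p. ucycle G p)"

section \<open>Rooted spanning forests\<close>

definition spanning_forest :: "'a ugraph \<Rightarrow> 'a ugraph \<Rightarrow> bool" where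
  "spanning_forest H G \<longleftrightarrow> is_subgraph H G \<and> uverts H = uverts G \<and> uacyclic H"

definition rooted_spanning_forests :: "'a ugraph \<Rightarrow> 'a set \<Rightarrow> 'a ugraph set" where
  "rooted_spanning_forests G R =
     {H. spanning_forest H G \<and> (\<forall>C\<in>ucomponents H. \<exists>!x. x \<in> C \<and> x \<in> R)}"

definition num_rooted_forests :: "'a ugraph \<Rightarrow> 'a set \<Rightarrow> nat" where
  "num_rooted_forests G R = card (rooted_spanning_forests G R)"

section \<open>Wheel graphs\<close>

datatype wheel_vertex = Hub | Rim nat

text \<open>
  \<open>wheel N\<close> has \<open>N + 1\<close> vertices. Rim indices run from 1 to \<open>N\<close>, so the
  cyclic successor of \<open>i\<close> is \<open>i mod N + 1\<close>.
\<close>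

definition wheel :: "nat \<Rightarrow> wheel_vertex ugraph" where
  "wheel N = UGraph
     (insert Hub (Rim ` {1..N}))
     ({{Rim i, Rim (i mod N + 1)} | i. i \<in> {1..N}} \<union> {{Hub, Rim i} | i. i \<in> {1..N}})"

lemma fin_simple_ugraph_wheel:
  assumes "3 \<le> N"
  shows "fin_simple_ugraph (wheel N)"
proof -
  have succ: "i mod N + 1 \<in> {1..N} \<and> i mod N + 1 \<noteq> i" if "i \<in> {1..N}" for i
    using that assms by (cases "i = N") auto
  have "\<exists>u\<in>uverts (wheel N). \<exists>v\<in>uverts (wheel N). u \<noteq> v \<and> e = {u, v}"
    if e: "e \<in> uedges (wheel N)" for e
  proof -
    from e consider i where "i \<in> {1..N}" "e = {Rim i, Rim (i mod N + 1)}"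
      | i where "i \<in> {1..N}" "e = {Hub, Rim i}"
      by (auto simp: wheel_def)
    then show ?thesis
    proof cases
      case 1
      have "Rim i \<in> uverts (wheel N)" "Rim (i mod N + 1) \<in> uverts (wheel N)"
        "Rim i \<noteq> Rim (i mod N + 1)"
        using succ[OF 1(1)] 1(1) by (auto simp: wheel_def)
      then show ?thesis using 1(2) by blast
    next
      case 2
      have "Hub \<in> uverts (wheel N)" "Rim i \<in> uverts (wheel N)" "Hub \<noteq> Rim i"
        using 2(1) by (auto simp: wheel_def)
      then show ?thesis using 2(2) by blast
    qed
  qed
  then show ?thesis
    by (simp add: fin_simple_ugraph_def) (simp add: wheel_def)
qed

lemma uconnected_wheel: "uconnected (wheel N)"
proof -
  let ?A = "{(x, y). {x, y} \<in> uedges (wheel N)}"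
  have "(u, Hub) \<in> ?A\<^sup>* \<and> (Hub, u) \<in> ?A\<^sup>*" if "u \<in> uverts (wheel N)" for u
  proof (cases u)
    case (Rim i)
    then have "{Hub, Rim i} \<in> uedges (wheel N)"
      using that by (auto simp: wheel_def)
    then have "(u, Hub) \<in> ?A" "(Hub, u) \<in> ?A"
      using Rim by (auto simp: insert_commute)
    then show ?thesis by blast
  qed simp
  then have "(u, v) \<in> ?A\<^sup>*" if "u \<in> uverts (wheel N)" "v \<in> uverts (wheel N)" for u v
    using that by (meson rtrancl_trans)
  then have "ureach (wheel N) = uverts (wheel N) \<times> uverts (wheel N)"
    by (auto simp: ureach_def)
  moreover have "Hub \<in> uverts (wheel N)"
    by (simp add: wheel_def)
  ultimately have "ucomponents (wheel N) = {uverts (wheel N)}"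
    by (auto simp: ucomponents_def quotient_def)
  then show ?thesis
    by (auto simp: uconnected_def)
qed

section \<open>Lucas numbers\<close>

fun lucas :: "nat \<Rightarrow> nat" where
  "lucas 0 = 2"
| "lucas (Suc 0) = 1"
| "lucas (Suc (Suc n)) = lucas (Suc n) + lucas n"

end

theory Submission
  imports Defs "HOL-Library.FuncSet"
begin

text \<open>
  Orienting every edge towards the root of its component turns a rooted spanning forest into a
  choice of a parent for every non-root vertex along which some height function decreases.

  On the wheel the roots cut the rim into arcs; the \<open>i\<close>-th arc has \<open>d\<^sub>i - 1\<close> interior
  vertices, each of which moves back, forth, or to the hub. The only cycles avoiding the hub are
  two neighbours pointing at each other, so the choices on an arc are the words without ``forth,
  back'', and there are \<open>F\<^bsub>2d\<^esub>\<close> of them. If the hub's parent is an interior vertex of an arc, then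
  that vertex must run straight to one end of the arc, which forces a prefix or a suffix of the
  word. Charging a root to the arc that starts there, the choices for the hub and the word on a
  given arc containing its parent number \<open>F\<^bsub>2d\<^esub> + 2(F\<^sub>2 + F\<^sub>4 + \<dots> + F\<^bsub>2d-2\<^esub>) = L\<^bsub>2d\<^esub> - 2\<close>.
\<close>

section \<open>Rooted forests as parent maps\<close>

text \<open>The strictly decreasing \<open>h\<close> expresses that following parents never runs in
  a circle. The maps are extensional so that arbitrary values on roots are not counted.\<close>

definition parent_maps :: "'a ugraph \<Rightarrow> 'a set \<Rightarrow> ('a \<Rightarrow> 'a) set" where
  "parent_maps G R =
     {p \<in> (uverts G - R) \<rightarrow>\<^sub>E uverts G.
        (\<forall>v\<in>uverts G - R. {v, p v} \<in> uedges G) \<and>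
        (\<exists>h :: 'a \<Rightarrow> nat. \<forall>v\<in>uverts G - R. h (p v) < h v)}"

definition parent_graph :: "'a ugraph \<Rightarrow> 'a set \<Rightarrow> ('a \<Rightarrow> 'a) \<Rightarrow> 'a ugraph" where
  "parent_graph G R p = UGraph (uverts G) ((\<lambda>v. {v, p v}) ` (uverts G - R))"

lemma parent_graph_edgeD:
  assumes "{x, y} \<in> uedges (parent_graph G R p)"
  shows "x \<in> uverts G - R \<and> y = p x \<or> y \<in> uverts G - R \<and> x = p y"
  using assms by (auto simp: parent_graph_def doubleton_eq_iff)

text \<open>Both neighbours of a highest vertex on a cycle would have to be its parent.\<close>

lemma parent_graph_uacyclic:
  assumes h: "\<And>v. v \<in> uverts G - R \<Longrightarrow> h (p v) < (h v :: nat)"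
  shows "uacyclic (parent_graph G R p)"
  unfolding uacyclic_def
proof
  assume "\<exists>c. ucycle (parent_graph G R p) c"
  then obtain c where len: "3 \<le> length c" and dist: "distinct c"
    and edge: "\<And>i. i < length c \<Longrightarrow> {c ! i, c ! (Suc i mod length c)} \<in> uedges (parent_graph G R p)"
    by (auto simp: ucycle_def)
  let ?n = "length c"
  obtain i where i: "i < ?n" and max: "\<And>j. j < ?n \<Longrightarrow> h (c ! j) \<le> h (c ! i)"
  proof -
    have "finite ((\<lambda>j. h (c ! j)) ` {..<?n})" "(\<lambda>j. h (c ! j)) ` {..<?n} \<noteq> {}"
      using len by (auto simp: lessThan_empty_iff)
    from Max_in[OF this] Max_ge[OF this(1)] that show ?thesis
      by (smt (verit, best) imageE imageI lessThan_iff)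
  qed
  \<comment> \<open>The cyclic predecessor of position \<open>i\<close>. As the length is at least
    3, it differs from the cyclic successor, which contradicts the equation derived below.\<close>
  define k where "k = (if i = 0 then ?n - 1 else i - 1)"
  have k: "k < ?n" "Suc k mod ?n = i"
    using i len by (auto simp: k_def)
  have up: "y = p x" if "{x, y} \<in> uedges (parent_graph G R p)" "h y \<le> h x" for x y
    using parent_graph_edgeD[OF that(1)] h that(2) by (metis leD)
  have s: "Suc i mod ?n < ?n" using len by (intro mod_less_divisor) linarith
  have "c ! (Suc i mod ?n) = p (c ! i)"
    using up edge[OF i] max[OF s] by blast
  moreover have "c ! k = p (c ! i)"
    using up[of "c ! i" "c ! k"] edge[OF k(1)] max[OF k(1)] k(2) by (simp add: insert_commute)
  ultimately have "Suc i mod ?n = k"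
    using dist s k(1) by (metis nth_eq_iff_index_eq)
  then show False
    using i len by (cases "Suc i = ?n") (auto simp: k_def split: if_splits)
qed

lemma uedges_ends:
  assumes "fin_simple_ugraph G" "{x, y} \<in> uedges G"
  shows "x \<in> uverts G" "y \<in> uverts G" "x \<noteq> y"
  using assms by (force simp: fin_simple_ugraph_def doubleton_eq_iff)+

text \<open>Each component is the reachability class of any of its vertices, so a condition on
  components can be checked vertex by vertex, without quotients.\<close>

lemma ucomponents_rooted_iff:
  assumes "fin_simple_ugraph G"
  shows "(\<forall>C\<in>ucomponents G. \<exists>!x. x \<in> C \<and> x \<in> R) \<longleftrightarrow>
    (\<forall>v\<in>uverts G. \<exists>!x. x \<in> R \<and> x \<in> uverts G \<and> (v, x) \<in> {(x, y). {x, y} \<in> uedges G}\<^sup>*)"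
  unfolding ucomponents_def quotient_def ureach_def
  by (simp add: conj_commute conj_left_commute conj_ac)

text \<open>Iterating the parent map leads from every vertex to a root. The root reached is constant
  along edges, hence on components, so no component contains two roots.\<close>

lemma parent_graph_rooted:
  assumes G: "fin_simple_ugraph G" and R: "R \<subseteq> uverts G"
    and p: "p \<in> parent_maps G R"
  shows "parent_graph G R p \<in> rooted_spanning_forests G R"
proof -
  let ?H = "parent_graph G R p" and ?V = "uverts G"
  let ?A = "{(x, y). {x, y} \<in> uedges ?H}"
  from p obtain h :: "'a \<Rightarrow> nat" where
    pV: "\<And>v. v \<in> ?V - R \<Longrightarrow> p v \<in> ?V" and pE: "\<And>v. v \<in> ?V - R \<Longrightarrow> {v, p v} \<in> uedges G"
    and h: "\<And>v. v \<in> ?V - R \<Longrightarrow> h (p v) < h v"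
    unfolding parent_maps_def by blast
  have fin: "finite ?V" using G by (simp add: fin_simple_ugraph_def)
  have V: "uverts ?H = ?V" by (simp add: parent_graph_def)
  have sub: "uedges ?H \<subseteq> uedges G" using pE by (auto simp: parent_graph_def)
  have H: "fin_simple_ugraph ?H"
    using G sub by (auto simp: fin_simple_ugraph_def V)
  have forest: "spanning_forest ?H G"
    using H V sub parent_graph_uacyclic[of G R h p] h
    by (auto simp: spanning_forest_def is_subgraph_def)
  define q where "q v = (if v \<in> R then v else p v)" for v
  \<comment> \<open>Each step towards a root lowers the height and \<open>q\<close> fixes roots, so
    overshooting is harmless and the maximal height is enough iterations for all vertices at
    once.\<close>
  define rt where "rt = q ^^ Max (h ` ?V)"
  have q: "q v \<in> ?V" if "v \<in> ?V" for v using that pV by (auto simp: q_def)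
  have stop: "(q ^^ n) v \<in> R" if "v \<in> ?V" "h v \<le> n" for n v
    using that
  proof (induction n arbitrary: v)
    case 0
    then show ?case using h[of v] by auto
  next
    case (Suc n)
    show ?case
    proof (cases "v \<in> R")
      case True
      then have "(q ^^ k) v = v" for k by (induction k) (auto simp: q_def)
      then show ?thesis using True by metis
    next
      case False
      then have "h (q v) \<le> n" using Suc.prems h[of v] by (auto simp: q_def)
      then have "(q ^^ n) (q v) \<in> R" using Suc.IH q Suc.prems(1) by blast
      then show ?thesis by (simp only: funpow_Suc_right o_apply)
    qed
  qed
  have rtR: "rt v \<in> R" if "v \<in> ?V" for v
    unfolding rt_def using that fin by (intro stop) auto
  have rt_q: "rt (q v) = rt v" if "v \<in> ?V" for v
  proof -
    have "rt (q v) = q (rt v)" by (simp add: rt_def funpow_swap1)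
    then show ?thesis using rtR[OF that] by (simp add: q_def)
  qed
  have rt_edge: "rt x = rt y" if "(x, y) \<in> ?A" for x y
    using parent_graph_edgeD[of x y G R p] that rt_q by (auto simp: q_def) (metis q_def rt_q)+
  have rt_reach: "rt x = rt y" if "(x, y) \<in> ?A\<^sup>*" for x y
    using that by induction (use rt_edge in auto)
  have rt_id: "rt x = x" if "x \<in> R" for x
  proof -
    have "(q ^^ k) x = x" for k using that by (induction k) (auto simp: q_def)
    then show ?thesis by (simp add: rt_def)
  qed
  have reach: "(v, (q ^^ n) v) \<in> ?A\<^sup>*" if "v \<in> ?V" for n v
  proof (induction n)
    case (Suc n)
    have "(q ^^ n) v \<in> ?V" using that q by (induction n) auto
    then have "q ((q ^^ n) v) = (q ^^ n) v \<or> ((q ^^ n) v, q ((q ^^ n) v)) \<in> ?A"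
      by (auto simp: q_def parent_graph_def)
    then show ?case using Suc by (auto intro: rtrancl_into_rtrancl)
  qed simp
  have "\<exists>!x. x \<in> R \<and> x \<in> uverts ?H \<and> (v, x) \<in> ?A\<^sup>*" if "v \<in> uverts ?H" for v
  proof (rule ex1I[of _ "rt v"])
    show "rt v \<in> R \<and> rt v \<in> uverts ?H \<and> (v, rt v) \<in> ?A\<^sup>*"
      using that V rtR R reach by (auto simp: rt_def)
  next
    fix x assume "x \<in> R \<and> x \<in> uverts ?H \<and> (v, x) \<in> ?A\<^sup>*"
    then show "x = rt v" using rt_reach rt_id by metis
  qed
  then show ?thesis
    using forest ucomponents_rooted_iff[OF H, of R] by (auto simp: rooted_spanning_forests_def)
qed

text \<open>If \<open>p v\<close> and \<open>q v\<close> differ, the common edge between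
  \<open>v\<close> and \<open>q v\<close> can only come from \<open>p (q v) = v\<close>. Since
  \<open>q v\<close> is lower than \<open>v\<close>, induction gives \<open>q (q v) = v\<close>,
  which the height of \<open>q\<close> forbids.\<close>

lemma parent_graph_inj: "inj_on (parent_graph G R) (parent_maps G R)"
proof (rule inj_onI)
  fix p q assume p: "p \<in> parent_maps G R" and q: "q \<in> parent_maps G R"
    and eq: "parent_graph G R p = parent_graph G R q"
  obtain h :: "'a \<Rightarrow> nat" where h: "\<And>v. v \<in> uverts G - R \<Longrightarrow> h (q v) < h v"
    using q unfolding parent_maps_def by blast
  have "p v = q v" if "v \<in> uverts G - R" for v
    using that
  proof (induction "h v" arbitrary: v rule: less_induct)
    case less
    show ?case
    proof (rule ccontr)
      assume ne: "p v \<noteq> q v"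
      have "{v, q v} \<in> uedges (parent_graph G R p)"
        unfolding eq using less.prems by (auto simp: parent_graph_def)
      from parent_graph_edgeD[OF this] ne
      have w: "q v \<in> uverts G - R" "p (q v) = v" by auto
      then have "q (q v) = v" using less.hyps h less.prems by metis
      then show False using h[OF w(1)] h[OF less.prems] by simp
    qed
  qed
  then show "p = q"
    using p q unfolding parent_maps_def by (auto intro: PiE_ext)
qed

text \<open>The path is grown edge by edge and cut back to the earlier visit whenever the new
  endpoint already lies on it.\<close>

lemma rtrancl_distinct_path:
  assumes "(u, v) \<in> A\<^sup>*"
  shows "\<exists>xs. xs \<noteq> [] \<and> hd xs = u \<and> last xs = v \<and> distinct xs \<and>
    (\<forall>i. Suc i < length xs \<longrightarrow> (xs ! i, xs ! Suc i) \<in> A)"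
  using assms
proof (induction rule: rtrancl_induct)
  case base
  show ?case by (rule exI[of _ "[u]"]) auto
next
  case (step y z)
  then obtain xs where xs: "xs \<noteq> []" "hd xs = u" "last xs = y" "distinct xs"
    "\<And>i. Suc i < length xs \<Longrightarrow> (xs ! i, xs ! Suc i) \<in> A" by blast
  show ?case
  proof (cases "z \<in> set xs")
    case True
    then obtain k where k: "k < length xs" "xs ! k = z" by (auto simp: in_set_conv_nth)
    then show ?thesis using xs
      by (intro exI[of _ "take (Suc k) xs"]) (auto simp: last_conv_nth hd_conv_nth min_def intro!: arg_cong[of _ _ "nth xs"])
  next
    case False
    have "(xs ! i, (xs @ [z]) ! Suc i) \<in> A" if "i < length xs" for i
    proof (cases "Suc i = length xs")
      case True
      then have "xs ! i = y" using xs(1,3) by (auto simp: last_conv_nth simp flip: True)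
      then show ?thesis using True step.hyps(2) by (simp add: nth_append)
    qed (use that xs(5) in \<open>simp add: nth_append\<close>)
    then show ?thesis using xs False
      by (intro exI[of _ "xs @ [z]"]) (auto simp: nth_append)
  qed
qed

text \<open>Otherwise a repetition-free path from \<open>u\<close> to \<open>v\<close> inside
  \<open>F\<close> would be closed by the edge between them to a cycle of \<open>H\<close>.\<close>

lemma uacyclic_edge_bridge:
  assumes "uacyclic H" "F \<subseteq> uedges H" "{u, v} \<in> uedges H" "u \<noteq> v"
    and "(u, v) \<in> {(x, y). {x, y} \<in> F}\<^sup>*"
  shows "{u, v} \<in> F"
proof (rule ccontr)
  assume nF: "{u, v} \<notin> F"
  obtain xs where xs: "xs \<noteq> []" "hd xs = u" "last xs = v" "distinct xs"
    "\<And>i. Suc i < length xs \<Longrightarrow> {xs ! i, xs ! Suc i} \<in> F"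
    using rtrancl_distinct_path[OF assms(5)] by auto
  \<comment> \<open>A cycle needs three vertices: length 1 would give \<open>u = v\<close>, and
    length 2 would put the edge itself into \<open>F\<close>.\<close>
  have "length xs \<noteq> 1" using xs(1-3) assms(4) by (auto simp: length_Suc_conv)
  moreover have "length xs \<noteq> 2"
    using xs(2,3) xs(5)[of 0] nF by (auto simp: numeral_2_eq_2 length_Suc_conv)
  ultimately have "3 \<le> length xs" using xs(1) by (cases xs rule: list.exhaust) (auto simp: Suc_le_eq numeral_eq_Suc neq_Nil_conv)
  moreover have "{xs ! i, xs ! (Suc i mod length xs)} \<in> uedges H" if "i < length xs" for i
  proof (cases "Suc i = length xs")
    case True
    then have "xs ! i = v" "xs ! 0 = u"
      using xs(1-3) by (auto simp: last_conv_nth hd_conv_nth simp flip: True)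
    then show ?thesis using True assms(3) by (simp add: insert_commute)
  next
    case False
    then show ?thesis using that xs(5)[of i] assms(2) by auto
  qed
  ultimately have "ucycle H xs" using xs(4) by (simp add: ucycle_def)
  then show False using assms(1) by (auto simp: uacyclic_def)
qed

text \<open>With \<open>h\<close> the distance to the root set inside \<open>H\<close>, the parent
  of a non-root is chosen as a neighbour at smaller distance. It remains to see that the chosen
  edges are all of \<open>H\<close>.\<close>

lemma parent_graph_surj:
  assumes H: "H \<in> rooted_spanning_forests G R"
  shows "H \<in> parent_graph G R ` parent_maps G R"
proof -
  let ?V = "uverts G" and ?A = "{(x, y). {x, y} \<in> uedges H}"
  have sg: "fin_simple_ugraph H" "uedges H \<subseteq> uedges G" and V: "uverts H = ?V"
    and acyc: "uacyclic H"
    using H by (auto simp: rooted_spanning_forests_def spanning_forest_def is_subgraph_def)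
  have root: "\<exists>!x. x \<in> R \<and> x \<in> ?V \<and> (v, x) \<in> ?A\<^sup>*" if "v \<in> ?V" for v
    using H that ucomponents_rooted_iff[OF sg(1), of R]
    by (auto simp: rooted_spanning_forests_def V)
  define h where "h v = (LEAST n. \<exists>x\<in>R. (v, x) \<in> ?A ^^ n)" for v
  have "\<exists>w. (v, w) \<in> ?A \<and> h w < h v" if v: "v \<in> ?V - R" for v
  proof -
    from root[of v] v obtain x n where "x \<in> R" "(v, x) \<in> ?A ^^ n"
      using rtrancl_imp_relpow by fast
    then have "\<exists>n. \<exists>x\<in>R. (v, x) \<in> ?A ^^ n" by blast
    from LeastI_ex[OF this] obtain x where x: "x \<in> R" "(v, x) \<in> ?A ^^ h v"
      unfolding h_def by blast
    from x v obtain n where n: "h v = Suc n" by (cases "h v") auto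
    from x(2) obtain w where w: "(v, w) \<in> ?A" "(w, x) \<in> ?A ^^ n"
      unfolding n by (meson relpow_Suc_D2)
    have "h w \<le> n" unfolding h_def[of w] using w(2) x(1) by (intro Least_le) blast
    then show ?thesis using w(1) n by auto
  qed
  then obtain p0 where p0: "\<And>v. v \<in> ?V - R \<Longrightarrow> (v, p0 v) \<in> ?A \<and> h (p0 v) < h v"
    by metis
  define p where "p = restrict p0 (?V - R)"
  have p: "{v, p v} \<in> uedges H" "h (p v) < h v" if "v \<in> ?V - R" for v
    using p0[OF that] that by (auto simp: p_def)
  have pV: "p v \<in> ?V" if "v \<in> ?V - R" for v
    using uedges_ends(2)[OF sg(1) p(1)[OF that]] V by simp
  have pm: "p \<in> parent_maps G R"
    unfolding parent_maps_def using p pV sg(2) by (auto simp: p_def)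
  let ?F = "uedges (parent_graph G R p)"
  let ?B = "{(x, y). {x, y} \<in> ?F}"
  have F: "?F \<subseteq> uedges H" using p(1) by (auto simp: parent_graph_def)
  have BA: "?B \<subseteq> ?A" using F by auto
  have sym: "sym (?B\<^sup>*)" by (intro sym_rtrancl symI) (auto simp: insert_commute)
  have reach: "\<exists>x\<in>R. x \<in> ?V \<and> (v, x) \<in> ?B\<^sup>*" if "v \<in> ?V" for v
    using that
  proof (induction "h v" arbitrary: v rule: less_induct)
    case less
    show ?case
    proof (cases "v \<in> R")
      case False
      then have v: "v \<in> ?V - R" using less.prems by simp
      obtain x where "x \<in> R" "x \<in> ?V" "(p v, x) \<in> ?B\<^sup>*"
        using less.hyps[OF p(2)[OF v] pV[OF v]] by blast
      moreover have "(v, p v) \<in> ?B" using v by (auto simp: parent_graph_def)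
      ultimately show ?thesis by (meson converse_rtrancl_into_rtrancl)
    qed (use less in auto)
  qed
  \<comment> \<open>The chosen edges already connect both ends of an edge of \<open>H\<close> to
    roots. These roots coincide by uniqueness in \<open>H\<close>, so the ends are joined by chosen
    edges, and acyclicity makes the edge itself a chosen one.\<close>
  have "uedges H \<subseteq> ?F"
  proof
    fix e assume e: "e \<in> uedges H"
    then obtain u v where uv: "e = {u, v}" "u \<noteq> v" "u \<in> ?V" "v \<in> ?V"
      using sg(1) unfolding fin_simple_ugraph_def V by metis
    obtain x where x: "x \<in> R" "x \<in> ?V" "(u, x) \<in> ?B\<^sup>*" using reach uv by blast
    obtain y where y: "y \<in> R" "y \<in> ?V" "(v, y) \<in> ?B\<^sup>*" using reach uv by blast
    have "(u, v) \<in> ?A" using e uv by auto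
    then have "(u, y) \<in> ?A\<^sup>*" "(u, x) \<in> ?A\<^sup>*"
      using x(3) y(3) rtrancl_mono[OF BA] by (auto intro: converse_rtrancl_into_rtrancl)
    then have "x = y" using root[OF uv(3)] x y by blast
    then have "(u, v) \<in> ?B\<^sup>*" using x(3) y(3) sym by (meson rtrancl_trans symD)
    then show "e \<in> ?F"
      using uacyclic_edge_bridge[OF acyc F] e uv by blast
  qed
  then have "H = parent_graph G R p"
    using F V by (intro ugraph.expand) (auto simp: parent_graph_def)
  then show ?thesis using pm by blast
qed

lemma num_rooted_forests_eq_card_parent_maps:
  assumes "fin_simple_ugraph G" "R \<subseteq> uverts G"
  shows "num_rooted_forests G R = card (parent_maps G R)"
proof -
  have "bij_betw (parent_graph G R) (parent_maps G R) (rooted_spanning_forests G R)"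
    using parent_graph_rooted[OF assms] parent_graph_surj
    by (intro bij_betw_imageI parent_graph_inj) blast
  then show ?thesis by (simp add: num_rooted_forests_def bij_betw_same_card)
qed

section \<open>Words on an arc\<close>

datatype move = Back | Forth | Spoke

definition arc_words :: "nat \<Rightarrow> move list set" where
  "arc_words m = {u. length u = m \<and> successively (\<lambda>x y. \<not> (x = Forth \<and> y = Back)) u}"

text \<open>
  The words compatible with the hub having position \<open>j\<close> of the arc as its parent. Position 0 is
  the root starting the arc, and position \<open>j > 0\<close> carries the letter \<open>u ! (j - 1)\<close>.
\<close>

definition hub_words :: "nat \<Rightarrow> nat \<Rightarrow> move list set" where
  "hub_words m j = {u \<in> arc_words m. j = 0 \<or> (\<forall>k<j. u ! k = Back) \<or> (\<forall>k<m. j \<le> Suc k \<longrightarrow> u ! k = Forth)}"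

lemma finite_arc_words: "finite (arc_words m)"
proof (rule finite_subset)
  show "arc_words m \<subseteq> {u. set u \<subseteq> {Back, Forth, Spoke} \<and> length u = m}"
    using move.exhaust by (auto simp: arc_words_def)
qed (rule finite_lists_length_eq, simp)

lemma arc_words_0: "arc_words 0 = {[]}"
  by (auto simp: arc_words_def)

lemma arc_words_Suc:
  "arc_words (Suc m) = (Cons Back ` arc_words m \<union> Cons Spoke ` arc_words m) \<union>
     Cons Forth ` {u \<in> arc_words m. u = [] \<or> hd u \<noteq> Back}" (is "_ = ?R")
proof (intro equalityI subsetI)
  fix u assume "u \<in> arc_words (Suc m)"
  then show "u \<in> ?R"
    by (cases u; cases "hd u") (auto simp: arc_words_def successively_Cons)
qed (auto simp: arc_words_def successively_Cons)

lemma card_arc_words_Back: "card {u \<in> arc_words (Suc m). u \<noteq> [] \<and> hd u = Back} = card (arc_words m)"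
proof -
  have "{u \<in> arc_words (Suc m). u \<noteq> [] \<and> hd u = Back} = Cons Back ` arc_words m"
    by (auto simp: arc_words_Suc)
  then show ?thesis by (simp add: card_image)
qed

text \<open>Any of three letters can be put in front of a word, except \<open>Forth\<close> before a
  word that starts with \<open>Back\<close>. The additive form avoids truncated subtraction.\<close>

lemma card_arc_words_Suc:
  "card (arc_words (Suc m)) + card {u \<in> arc_words m. u \<noteq> [] \<and> hd u = Back} = 3 * card (arc_words m)"
proof -
  let ?B = "{u \<in> arc_words m. u \<noteq> [] \<and> hd u = Back}" and ?N = "{u \<in> arc_words m. u = [] \<or> hd u \<noteq> Back}"
  have "card (?N \<union> ?B) = card ?N + card ?B"
    by (intro card_Un_disjoint) (auto simp: finite_arc_words)
  moreover have "?N \<union> ?B = arc_words m" by auto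
  moreover have "card (arc_words (Suc m)) = card (arc_words m) + card (arc_words m) + card ?N"
    unfolding arc_words_Suc
    by (subst card_Un_disjoint, auto simp: finite_arc_words card_image)+
  ultimately show ?thesis by simp
qed

text \<open>Words starting with \<open>Back\<close> correspond to words one letter shorter, so the
  counts satisfy c(m+2) + c(m) = 3 c(m+1), the recurrence of the Fibonacci numbers of even
  index.\<close>

lemma card_arc_words: "card (arc_words m) = fib (2 * Suc m)"
proof (induction m rule: induct_nat_012)
  case 0
  show ?case by (simp add: arc_words_0)
next
  case 1
  have none: "{u \<in> arc_words 0. u \<noteq> [] \<and> hd u = Back} = {}" by (auto simp: arc_words_0)
  have "card (arc_words (Suc 0)) = 3"
    using card_arc_words_Suc[of 0] unfolding none by (simp add: arc_words_0)
  then show ?case by (simp add: numeral_eq_Suc)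
next
  case (ge2 m)
  then show ?case using card_arc_words_Suc[of "Suc m"] by (simp add: card_arc_words_Back)
qed

text \<open>A \<open>Back\<close> run to the first root fixes \<open>j\<close> letters and leaves
  \<open>m - j\<close> free; a \<open>Forth\<close> run to the far root leaves \<open>j - 1\<close>
  free. Neither run restricts the neighbouring free letter, and the letter at index
  \<open>j - 1\<close> tells the two cases apart.\<close>

lemma card_hub_words:
  assumes "1 \<le> j" "j \<le> m"
  shows "card (hub_words m j) = card (arc_words (m - j)) + card (arc_words (j - 1))"
proof -
  let ?f = "\<lambda>u. replicate j Back @ u" and ?g = "\<lambda>u. u @ replicate (Suc m - j) Forth"
  have "hub_words m j = ?f ` arc_words (m - j) \<union> ?g ` arc_words (j - 1)"
  proof (intro equalityI subsetI)
    fix u assume "u \<in> hub_words m j"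
    then have u: "u \<in> arc_words m" and
      dir: "(\<forall>k<j. u ! k = Back) \<or> (\<forall>k<m. j \<le> Suc k \<longrightarrow> u ! k = Forth)"
      using assms by (auto simp: hub_words_def)
    then have len: "length u = m" by (simp add: arc_words_def)
    have parts: "take n u \<in> arc_words n" "drop n u \<in> arc_words (m - n)" if "n \<le> m" for n
      using u that successively_append_iff[of _ "take n u" "drop n u"] by (auto simp: arc_words_def)
    from dir show "u \<in> ?f ` arc_words (m - j) \<union> ?g ` arc_words (j - 1)"
    proof
      assume "\<forall>k<j. u ! k = Back"
      then have "take j u = replicate j Back" using len assms by (intro nth_equalityI) auto
      then have "u = ?f (drop j u)" by (metis append_take_drop_id)
      then show ?thesis using parts(2)[of j] assms by blast
    next
      assume "\<forall>k<m. j \<le> Suc k \<longrightarrow> u ! k = Forth"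
      then have "drop (j - 1) u = replicate (Suc m - j) Forth"
        using len assms by (intro nth_equalityI) auto
      then have "u = ?g (take (j - 1) u)" by (metis append_take_drop_id)
      then show ?thesis using parts(1)[of "j - 1"] assms by fastforce
    qed
  next
    have rep: "successively (\<lambda>x y. \<not> (x = Forth \<and> y = Back)) (replicate n c)" for n c
      by (auto simp: successively_conv_nth)
    fix u assume "u \<in> ?f ` arc_words (m - j) \<union> ?g ` arc_words (j - 1)"
    then show "u \<in> hub_words m j"
      using assms rep by (auto simp: hub_words_def arc_words_def successively_append_iff nth_append)
  qed
  moreover have "?f ` arc_words (m - j) \<inter> ?g ` arc_words (j - 1) = {}"
  proof -
    have "?f u \<noteq> ?g v" if "v \<in> arc_words (j - 1)" for u v
    proof
      assume "?f u = ?g v"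
      then have "?f u ! (j - 1) = ?g v ! (j - 1)" by simp
      then show False using that assms by (simp add: arc_words_def nth_append)
    qed
    then show ?thesis by blast
  qed
  ultimately show ?thesis
    by (simp add: card_Un_disjoint finite_arc_words card_image inj_on_def)
qed

lemma lucas_conv_fib: "lucas (Suc n) = fib n + fib (Suc (Suc n))"
  by (induction n rule: induct_nat_012) auto

text \<open>Position 0 leaves the whole word free. Over the other positions, the two free lengths
  \<open>m - j\<close> and \<open>j - 1\<close> each take every value below \<open>m\<close> once,
  whence the factor 2.\<close>

lemma sum_card_hub_words: "(\<Sum>j<Suc m. card (hub_words m j)) + 2 = lucas (2 * Suc m)"
proof -
  have "(\<Sum>j<Suc m. card (hub_words m j)) =
      card (arc_words m) + (\<Sum>j<m. card (arc_words (m - Suc j)) + card (arc_words j))"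
    unfolding sum.lessThan_Suc_shift
    by (intro arg_cong2[of _ _ _ _ "(+)"] sum.cong) (auto simp: card_hub_words hub_words_def[of _ 0])
  also have "\<dots> = card (arc_words m) + 2 * (\<Sum>j<m. card (arc_words j))"
    by (simp add: sum.distrib sum.nat_diff_reindex[of "\<lambda>j. card (arc_words j)"])
  also have "\<dots> + 2 = lucas (2 * Suc m)"
    \<comment> \<open>Passing from \<open>m\<close> to \<open>m + 1\<close> adds F(2m+2) + F(2m+4) =
      L(2m+3), which is the Lucas increment.\<close>
    by (induction m) (simp_all add: card_arc_words lucas_conv_fib numeral_2_eq_2)
  finally show ?thesis by simp
qed

section \<open>Wheels with rim roots\<close>

locale rooted_wheel =
  fixes N r :: nat and a d :: "nat \<Rightarrow> nat"
  assumes N: "3 \<le> N" and r: "1 \<le> r" and a_ge: "1 \<le> a 1"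
    and a_mono: "strict_mono_on {1..r} a" and a_le: "a r \<le> N"
    and d: "\<And>i. 1 \<le> i \<Longrightarrow> i \<le> r - 1 \<Longrightarrow> d i = a (i + 1) - a i"
    and d_last: "d r = a 1 + N - a r"
begin

text \<open>
  \<open>rim i j\<close> lies \<open>j\<close> steps after the \<open>i\<close>-th root; \<open>rim i (d i)\<close> is the next root.
\<close>

definition rim :: "nat \<Rightarrow> nat \<Rightarrow> wheel_vertex" where
  "rim i j = Rim ((a i + j - 1) mod N + 1)"

text \<open>Coordinates of the rim vertices. The far end \<open>d i\<close> of an arc is left out
  because it is position 0 of the next one.\<close>

definition slots :: "(nat \<times> nat) set" where
  "slots = (SIGMA i:{1..r}. {..<d i})"

definition roots :: "wheel_vertex set" where
  "roots = {Rim (a i) | i. i \<in> {1..r}}"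

lemma a_less: "a i < a j" if "i \<in> {1..r}" "j \<in> {1..r}" "i < j" for i j
  using a_mono that by (auto simp: strict_mono_on_def)

lemma a_bounds: "1 \<le> a i" "a i \<le> N" if "i \<in> {1..r}"
proof -
  show "1 \<le> a i" using a_less[of 1 i] that a_ge r by (cases "i = 1") auto
  show "a i \<le> N" using a_less[of i r] that a_le r by (cases "i = r") auto
qed

lemma d_pos: "0 < d i" if "i \<in> {1..r}"
proof (cases "i = r")
  case True
  then show ?thesis using d_last a_le a_ge by auto
next
  case False
  then show ?thesis using d[of i] a_less[of i "i + 1"] that by auto
qed

lemma rim_0: "rim i 0 = Rim (a i)" if "i \<in> {1..r}"
  using a_bounds[OF that] N by (simp add: rim_def)

lemma rim_Suc:
  assumes "i \<in> {1..r}" "rim i j = Rim x"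
  shows "rim i (Suc j) = Rim (x mod N + 1)"
  using a_bounds[OF assms(1)] assms(2) by (auto simp: rim_def mod_simps)

lemma rim_neq_Hub [simp]: "rim i j \<noteq> Hub" "Hub \<noteq> rim i j"
  by (simp_all add: rim_def)

lemma rim_range: "rim i j \<in> Rim ` {1..N}"
  using N mod_less_divisor[of N] by (auto simp: rim_def Suc_le_eq)

lemma rim_end: "rim i (d i) \<in> roots" if "i \<in> {1..r}"
proof (cases "i = r")
  case True
  \<comment> \<open>The last arc wraps round: \<open>a r\<close> cancels against \<open>d r\<close>,
    leaving the first root shifted by \<open>N\<close>.\<close>
  have "rim r (d r) = Rim (((a 1 - 1) + N) mod N + 1)"
    using d_last a_le a_ge by (simp add: rim_def)
  moreover have "a 1 \<le> N" using a_bounds[of 1] r by simp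
  ultimately have "rim r (d r) = Rim (a 1)" using a_ge by (simp del: Nat.add_diff_assoc2)
  then show ?thesis using True r by (auto simp: roots_def)
next
  case False
  then have "i + 1 \<in> {1..r}" "a i < a (i + 1)" "d i = a (i + 1) - a i"
    using that d[of i] a_less[of i "i + 1"] by auto
  moreover from this have "rim i (d i) = rim (i + 1) 0" by (simp add: rim_def)
  ultimately show ?thesis using rim_0 by (auto simp: roots_def)
qed

text \<open>A rim vertex lies on the arc of the last root at or before it; vertices before the first
  root belong to the wrapping last arc.\<close>

lemma rim_covers: "case_prod rim ` slots = Rim ` {1..N}"
proof (intro equalityI subsetI)
  fix v assume "v \<in> Rim ` {1..N}"
  then obtain x where x: "v = Rim x" "1 \<le> x" "x \<le> N" by auto
  have "\<exists>(i, j)\<in>slots. rim i j = v"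
  proof (cases "a 1 \<le> x")
    case False
    have "rim r (x + N - a r) = Rim (((x - 1) + N) mod N + 1)"
      using x(2) a_le by (simp add: rim_def)
    then have "rim r (x + N - a r) = v" using x by (simp del: Nat.add_diff_assoc2)
    moreover have "x + N - a r < d r" using False a_le d_last by simp
    ultimately have "rim r (x + N - a r) = v" "x + N - a r < d r" by blast+
    then show ?thesis using r by (auto simp: slots_def intro!: bexI[of _ "(r, x + N - a r)"])
  next
    case True
    define I where "I = {i \<in> {1..r}. a i \<le> x}"
    have I: "finite I" "I \<noteq> {}" using True r by (auto simp: I_def)
    define i where "i = Max I"
    have i: "i \<in> {1..r}" "a i \<le> x" using Max_in[OF I] by (auto simp: I_def i_def)
    have "x - a i < d i"
    proof (cases "i = r")
      case True
      then show ?thesis using x i d_last a_ge by auto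
    next
      case False
      then have "i + 1 \<notin> I" using Max_ge[OF I(1), of "i + 1"] by (auto simp: i_def)
      then show ?thesis using False i d[of i] by (auto simp: I_def)
    qed
    moreover have "rim i (x - a i) = v" using i x by (auto simp: rim_def)
    ultimately show ?thesis using i by (auto simp: slots_def intro!: bexI[of _ "(i, x - a i)"])
  qed
  then show "v \<in> case_prod rim ` slots" by force
qed (use rim_range in auto)

lemma sum_d: "(\<Sum>i=1..r. d i) = N"
proof -
  have "(\<Sum>i=1..<n. d i) + a 1 = a n" if "1 \<le> n" "n \<le> r" for n
    using that
  proof (induction n rule: nat_induct_at_least)
    case (Suc n)
    then have "d n + a n = a (Suc n)" using d[of n] a_less[of n "Suc n"] by auto
    then show ?case using Suc by simp
  qed simp
  from this[of r] show ?thesis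
    using r d_last a_le by (simp add: sum.last_plus)
qed

text \<open>There are exactly \<open>N\<close> slots and they cover \<open>N\<close> vertices, so
  surjectivity forces injectivity and no comparison of arcs is needed.\<close>

lemma rim_inj: "inj_on (case_prod rim) slots"
proof (rule eq_card_imp_inj_on)
  show "finite slots" by (simp add: slots_def)
  have "card slots = N" using sum_d by (simp add: slots_def)
  then show "card (case_prod rim ` slots) = card slots"
    unfolding rim_covers by (simp add: card_image inj_on_def)
qed

lemma rim_eq_iff:
  assumes "(i, j) \<in> slots" "(i', j') \<in> slots"
  shows "rim i j = rim i' j' \<longleftrightarrow> i = i' \<and> j = j'"
  using inj_onD[OF rim_inj _ assms] by auto

lemma roots_eq: "roots = {rim i 0 | i. i \<in> {1..r}}"
  using rim_0 by (force simp: roots_def)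

lemma verts_wheel: "uverts (wheel N) = insert Hub (Rim ` {1..N})"
  by (simp add: wheel_def)

lemma rim_in_roots_iff: "(i, j) \<in> slots \<Longrightarrow> rim i j \<in> roots \<longleftrightarrow> j = 0"
  using rim_eq_iff[of i j _ 0] d_pos by (auto simp: roots_eq slots_def)

lemma nonroots: "uverts (wheel N) - roots = insert Hub {rim i j | i j. (i, j) \<in> slots \<and> 0 < j}"
proof -
  have "Hub \<notin> roots" by (auto simp: roots_def)
  then show ?thesis
    unfolding verts_wheel rim_covers[symmetric] using rim_in_roots_iff by fastforce
qed

section \<open>Moves to the neighbours of a rim vertex\<close>

lemma succ_inj:
  assumes "x \<in> {1..N}" "y \<in> {1..N}" "x mod N = y mod N"
  shows "x = y"
  using assms by (cases "x = N"; cases "y = N") auto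

definition move_target :: "nat \<Rightarrow> nat \<Rightarrow> move \<Rightarrow> wheel_vertex" where
  "move_target i j m = (case m of Back \<Rightarrow> rim i (j - 1) | Forth \<Rightarrow> rim i (Suc j) | Spoke \<Rightarrow> Hub)"

lemma move_target_simps [simp]:
  "move_target i j Back = rim i (j - 1)"
  "move_target i j Forth = rim i (Suc j)"
  "move_target i j Spoke = Hub"
  by (simp_all add: move_target_def)

lemma Hub_edge_iff: "{Hub, v} \<in> uedges (wheel N) \<longleftrightarrow> v \<in> Rim ` {1..N}"
  by (auto simp: wheel_def doubleton_eq_iff)

lemma Rim_edge_iff:
  "{Rim x, Rim y} \<in> uedges (wheel N) \<longleftrightarrow>
    x \<in> {1..N} \<and> y = x mod N + 1 \<or> y \<in> {1..N} \<and> x = y mod N + 1"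
  by (auto simp: wheel_def doubleton_eq_iff)

lemma rim_edge_iff:
  assumes "i \<in> {1..r}" "0 < j"
  shows "{rim i j, v} \<in> uedges (wheel N) \<longleftrightarrow> (\<exists>m. v = move_target i j m)"
proof -
  obtain x where x: "x \<in> {1..N}" "rim i (j - 1) = Rim x" using rim_range by blast
  obtain y where y: "y \<in> {1..N}" "rim i j = Rim y" using rim_range by blast
  have yx: "y = x mod N + 1" using rim_Suc[OF assms(1) x(2)] assms(2) y(2) by simp
  have z: "rim i (Suc j) = Rim (y mod N + 1)" using rim_Suc[OF assms(1) y(2)] .
  have ex: "(\<exists>m. v = move_target i j m) \<longleftrightarrow> v = Rim x \<or> v = Rim (y mod N + 1) \<or> v = Hub"
    using x(2) z by (metis move.exhaust move_target_simps)
  show ?thesis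
  proof (cases v)
    case Hub
    then show ?thesis using y ex Hub_edge_iff[of "Rim y"] by (auto simp: insert_commute)
  next
    case (Rim w)
    have "w \<in> {1..N} \<and> y = w mod N + 1 \<longleftrightarrow> w = x"
      using yx x(1) succ_inj[of w x] by (metis add_right_cancel)
    then show ?thesis
      unfolding ex unfolding Rim y(2) Rim_edge_iff using y(1) by auto
  qed
qed

text \<open>With at least three rim vertices, two steps along the rim do not lead back to the start,
  so the two rim neighbours differ.\<close>

lemma move_target_inj:
  assumes "i \<in> {1..r}" "0 < j" "move_target i j m = move_target i j m'"
  shows "m = m'"
proof -
  obtain x where x: "x \<in> {1..N}" "rim i (j - 1) = Rim x" using rim_range by blast
  have "rim i j = Rim (x mod N + 1)" using rim_Suc[OF assms(1) x(2)] assms(2) by simp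
  then have "rim i (Suc j) = Rim ((x mod N + 1) mod N + 1)" using rim_Suc[OF assms(1)] by simp
  moreover have "(x mod N + 1) mod N + 1 \<noteq> x"
    using x(1) N by (cases "x = N"; cases "x + 1 = N") auto
  ultimately have "rim i (Suc j) \<noteq> rim i (j - 1)" using x(2) by simp
  then show ?thesis using assms(3) by (cases m; cases m') auto
qed

section \<open>From hub slots and words to parent maps, and their heights\<close>

definition parent_of :: "(nat \<times> nat) \<times> (nat \<Rightarrow> move list) \<Rightarrow> wheel_vertex \<Rightarrow> wheel_vertex" where
  "parent_of = (\<lambda>(k, w). \<lambda>v\<in>uverts (wheel N) - roots.
     if v = Hub then case_prod rim k
     else case inv_into slots (case_prod rim) v of (i, j) \<Rightarrow> move_target i j (w i ! (j - 1)))"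

lemma parent_of_Hub [simp]: "parent_of (k, w) Hub = case_prod rim k"
  by (simp add: parent_of_def nonroots)

lemma inv_rim: "(i, j) \<in> slots \<Longrightarrow> inv_into slots (case_prod rim) (rim i j) = (i, j)"
  using inv_into_f_f[OF rim_inj, of "(i, j)"] by simp

lemma parent_of_rim [simp]:
  assumes "(i, j) \<in> slots" "0 < j"
  shows "parent_of (k, w) (rim i j) = move_target i j (w i ! (j - 1))"
proof -
  have "rim i j \<in> uverts (wheel N) - roots" using assms nonroots by blast
  then show ?thesis using assms by (simp add: parent_of_def inv_rim)
qed

text \<open>
  The vertices lying on the hub's way to its root (those satisfying \<open>Q\<close> in the proof) are placed
  below the hub, all other non-root vertices above it.
\<close>

lemma heightI:
  assumes k: "(i\<^sub>0, j\<^sub>0) \<in> slots"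
    and arcs: "\<And>i. i \<in> {1..r} \<Longrightarrow> w i \<in> arc_words (d i - 1)"
    and hub: "w i\<^sub>0 \<in> hub_words (d i\<^sub>0 - 1) j\<^sub>0"
  shows "\<exists>h :: wheel_vertex \<Rightarrow> nat. \<forall>v\<in>uverts (wheel N) - roots. h (parent_of ((i\<^sub>0, j\<^sub>0), w) v) < h v"
proof -
  define Q where "Q i j \<longleftrightarrow> i = i\<^sub>0 \<and> 0 < j\<^sub>0 \<and>
    ((\<forall>k<j\<^sub>0. w i ! k = Back) \<and> j \<le> j\<^sub>0 \<or> (\<forall>k<d i - 1. j\<^sub>0 \<le> Suc k \<longrightarrow> w i ! k = Forth) \<and> j\<^sub>0 \<le> j)" for i j
  \<comment> \<open>Number of rim steps to the end of the arc in the current direction, dropping by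
    one along a run of equal letters; \<open>Spoke\<close> serves as base value.\<close>
  define b where "b i j = (case w i ! (j - 1) of Back \<Rightarrow> j | Forth \<Rightarrow> d i - j | Spoke \<Rightarrow> 0)" for i j
  \<comment> \<open>The hub will have height \<open>d i\<^sub>0\<close>. On its way to a root
    \<open>b\<close> stays below that, and the shift by \<open>d i\<^sub>0 + 1\<close> lifts every
    other non-root above it, so \<open>Spoke\<close> moves descend.\<close>
  define g where "g i j = (if j = 0 \<or> j = d i then 0 else if Q i j then b i j else d i\<^sub>0 + 1 + b i j)" for i j
  define h where "h v = (if v = Hub then d i\<^sub>0 else if v \<in> roots then 0
    else case_prod g (inv_into slots (case_prod rim) v))" for v
  have h_rim: "h (rim i j) = g i j" if "i \<in> {1..r}" "j \<le> d i" for i j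
  proof (cases "j = d i")
    case True
    then show ?thesis using rim_end that by (simp add: h_def g_def)
  next
    case False
    then have "(i, j) \<in> slots" using that by (auto simp: slots_def)
    then show ?thesis using rim_in_roots_iff inv_rim by (auto simp: h_def g_def)
  qed
  have k': "i\<^sub>0 \<in> {1..r}" "j\<^sub>0 < d i\<^sub>0" using k by (auto simp: slots_def)
  have "h (rim i\<^sub>0 j\<^sub>0) < h Hub"
  proof (cases "j\<^sub>0 = 0")
    case True
    then show ?thesis using k' by (simp add: h_rim g_def) (simp add: h_def)
  next
    case False
    then have "Q i\<^sub>0 j\<^sub>0" using hub by (auto simp: Q_def hub_words_def)
    then show ?thesis using k' False
      by (simp add: h_rim g_def) (auto simp: h_def b_def split: move.split)
  qed
  moreover have "h (move_target i j (w i ! (j - 1))) < h (rim i j)"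
    if ij: "(i, j) \<in> slots" "0 < j" for i j
  proof -
    have i: "i \<in> {1..r}" "j < d i" using ij by (auto simp: slots_def)
    have no: "\<not> (w i ! n = Forth \<and> w i ! Suc n = Back)" if "Suc n < d i - 1" for n
      using arcs[OF i(1)] that by (auto simp: arc_words_def successively_conv_nth)
    have Q_dir: "w i ! (j - 1) = Back \<and> (\<forall>k<j. w i ! k = Back) \<and> j \<le> j\<^sub>0 \<or>
        w i ! (j - 1) = Forth \<and> (\<forall>k<d i - 1. j \<le> Suc k \<longrightarrow> w i ! k = Forth) \<and> j\<^sub>0 \<le> j" if "Q i j"
      using that i ij by (auto simp: Q_def)
    show ?thesis
    proof (cases "w i ! (j - 1)")
      case Spoke
      then have "\<not> Q i j" using Q_dir by auto
      then show ?thesis using Spoke i ij by (simp add: h_rim g_def) (simp add: h_def)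
    next
      case Back
      have "g i (j - 1) < g i j"
      proof (cases "j = 1")
        case True
        then show ?thesis using i Back by (simp add: g_def b_def)
      next
        case False
        \<comment> \<open>Index \<open>j - 2\<close> holds the letter of the vertex behind. Without
          \<open>Forth\<close> it is \<open>Back\<close>, with \<open>b\<close> one smaller, or
          \<open>Spoke\<close>, with \<open>b\<close> equal to 0.\<close>
        then have ne: "w i ! (j - 2) \<noteq> Forth"
          using no[of "j - 2"] Back i ij by (auto simp: Suc_diff_Suc numeral_2_eq_2)
        have "Q i (j - 1) \<and> w i ! (j - 2) = Back" if "Q i j"
          using Q_dir[OF that] that False Back ij by (auto simp: Q_def)
        then show ?thesis using ne False i ij Back
          by (cases "w i ! (j - 2)") (auto simp: g_def b_def numeral_2_eq_2)
      qed
      then show ?thesis using Back i ij by (simp add: h_rim)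
    next
      case Forth
      have "g i (Suc j) < g i j"
      proof (cases "Suc j = d i")
        case True
        then show ?thesis using i Forth ij by (simp add: g_def b_def)
      next
        case False
        then have ne: "w i ! j \<noteq> Back"
          using no[of "j - 1"] Forth i ij by auto
        have "Q i (Suc j) \<and> w i ! j = Forth" if "Q i j"
          using Q_dir[OF that] that False Forth i ij by (auto simp: Q_def)
        then show ?thesis using ne False i ij Forth
          by (cases "w i ! j") (auto simp: g_def b_def)
      qed
      then show ?thesis using Forth i ij by (simp add: h_rim)
    qed
  qed
  ultimately show ?thesis by (intro exI[of _ h]) (auto simp: nonroots)
qed

text \<open>\<open>Forth\<close> followed by \<open>Back\<close> would put each of two vertices
  below the other. From the hub's parent on, all vertices reached lie below the hub, so none moves
  to the hub, and none can turn round: the run continues to the end of the arc.\<close>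

lemma heightD:
  fixes h :: "wheel_vertex \<Rightarrow> nat"
  assumes k: "(i\<^sub>0, j\<^sub>0) \<in> slots"
    and len: "\<And>i. i \<in> {1..r} \<Longrightarrow> length (w i) = d i - 1"
    and h: "\<And>v. v \<in> uverts (wheel N) - roots \<Longrightarrow> h (parent_of ((i\<^sub>0, j\<^sub>0), w) v) < h v"
  shows "i \<in> {1..r} \<Longrightarrow> w i \<in> arc_words (d i - 1)" "w i\<^sub>0 \<in> hub_words (d i\<^sub>0 - 1) j\<^sub>0"
proof -
  have hub: "h (rim i\<^sub>0 j\<^sub>0) < h Hub" using h[of Hub] by (simp add: nonroots)
  have rim: "h (move_target i (Suc n) (w i ! n)) < h (rim i (Suc n))"
    if "i \<in> {1..r}" "n < d i - 1" for i n
  proof -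
    have s: "(i, Suc n) \<in> slots" using that by (auto simp: slots_def)
    then have "rim i (Suc n) \<in> uverts (wheel N) - roots" unfolding nonroots by blast
    from h[OF this] s show ?thesis by simp
  qed
  have no: "\<not> (w i ! n = Forth \<and> w i ! Suc n = Back)" if "i \<in> {1..r}" "Suc n < d i - 1" for i n
    using rim[of i n] rim[of i "Suc n"] that by auto
  show arc: "w i \<in> arc_words (d i - 1)" if "i \<in> {1..r}" for i
    using len[OF that] no[OF that] by (auto simp: arc_words_def successively_conv_nth)
  have i: "i\<^sub>0 \<in> {1..r}" "j\<^sub>0 < d i\<^sub>0" using k by (auto simp: slots_def)
  let ?u = "w i\<^sub>0"
  show "?u \<in> hub_words (d i\<^sub>0 - 1) j\<^sub>0"
  proof (cases j\<^sub>0)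
    case 0
    then show ?thesis using arc[OF i(1)] by (simp add: hub_words_def)
  next
    case (Suc j)
    have "(\<forall>k<j\<^sub>0. ?u ! k = Back) \<or> (\<forall>k<d i\<^sub>0 - 1. j\<^sub>0 \<le> Suc k \<longrightarrow> ?u ! k = Forth)"
    proof (cases "?u ! j")
      case Spoke
      then show ?thesis using rim[OF i(1), of j] hub i(2) Suc by fastforce
    next
      case Back
      \<comment> \<open>Walking back \<open>n\<close> positions. Being below the hub is carried
        along because it is what rules out \<open>Spoke\<close> at the next vertex.\<close>
      have "?u ! (j - n) = Back \<and> h (rim i\<^sub>0 (Suc (j - n))) < h Hub" if "n \<le> j" for n
        using that
      proof (induction n)
        case 0
        then show ?case using Back hub Suc by simp
      next
        case (Suc n)
        define l where "l = j - Suc n"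
        have l: "j - n = Suc l" "Suc l < d i\<^sub>0 - 1" using Suc.prems i(2) \<open>j\<^sub>0 = Suc j\<close> by (auto simp: l_def)
        have u: "?u ! Suc l = Back" "h (rim i\<^sub>0 (Suc (Suc l))) < h Hub"
          using Suc l(1) by auto
        have lt: "h (rim i\<^sub>0 (Suc l)) < h Hub"
          using rim[OF i(1) l(2)] u by simp
        moreover have "?u ! l = Back"
          using no[OF i(1) l(2)] u(1) rim[OF i(1), of l] l(2) lt by (cases "?u ! l") auto
        ultimately show ?case by (simp add: l_def)
      qed
      then have "?u ! k = Back" if "k < j\<^sub>0" for k
        using that Suc by (metis diff_diff_cancel diff_le_self less_Suc_eq_le)
      then show ?thesis by blast
    next
      case Forth
      have "?u ! (j + n) = Forth \<and> h (rim i\<^sub>0 (Suc (j + n))) < h Hub" if "j + n < d i\<^sub>0 - 1" for n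
        using that
      proof (induction n)
        case 0
        then show ?case using Forth hub Suc by simp
      next
        case (Suc n)
        have u: "?u ! (j + n) = Forth" "h (rim i\<^sub>0 (Suc (j + n))) < h Hub" using Suc by auto
        have lt: "h (rim i\<^sub>0 (Suc (Suc (j + n)))) < h Hub"
          using rim[OF i(1), of "j + n"] u Suc.prems by simp
        moreover have "?u ! Suc (j + n) = Forth"
          using no[OF i(1), of "j + n"] u(1) rim[OF i(1), of "Suc (j + n)"] Suc.prems lt
          by (cases "?u ! Suc (j + n)") auto
        ultimately show ?case by simp
      qed
      then have "?u ! k = Forth" if "k < d i\<^sub>0 - 1" "j\<^sub>0 \<le> Suc k" for k
        using that Suc by (metis Suc_le_mono le_iff_add)
      then show ?thesis by blast
    qed
    then show ?thesis using arc[OF i(1)] by (simp add: hub_words_def)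
  qed
qed

section \<open>The bijection between codes and parent maps, and the count\<close>

definition codes :: "((nat \<times> nat) \<times> (nat \<Rightarrow> move list)) set" where
  "codes = (SIGMA k:slots. \<Pi>\<^sub>E i\<in>{1..r}.
     if i = fst k then hub_words (d i - 1) (snd k) else arc_words (d i - 1))"

lemma hub_words_subset: "hub_words m j \<subseteq> arc_words m"
  by (auto simp: hub_words_def)

text \<open>Since \<open>hub_words\<close> lies inside \<open>arc_words\<close>, the arc condition
  can be asked of all arcs and the hub condition added separately.\<close>

lemma codes_iff:
  "((i\<^sub>0, j\<^sub>0), w) \<in> codes \<longleftrightarrow> (i\<^sub>0, j\<^sub>0) \<in> slots \<and> w \<in> extensional {1..r} \<and>
     (\<forall>i\<in>{1..r}. w i \<in> arc_words (d i - 1)) \<and> w i\<^sub>0 \<in> hub_words (d i\<^sub>0 - 1) j\<^sub>0"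
proof (cases "(i\<^sub>0, j\<^sub>0) \<in> slots")
  case True
  then have "i\<^sub>0 \<in> {1..r}" by (simp add: slots_def)
  then show ?thesis
    using True hub_words_subset[of "d i\<^sub>0 - 1" j\<^sub>0] by (auto simp: codes_def PiE_iff split: if_splits)
qed (simp add: codes_def)

lemma parent_of_in_parent_maps:
  assumes "c \<in> codes"
  shows "parent_of c \<in> parent_maps (wheel N) roots"
proof -
  obtain i\<^sub>0 j\<^sub>0 w where c: "c = ((i\<^sub>0, j\<^sub>0), w)" by (metis prod.exhaust)
  have edge: "{v, parent_of c v} \<in> uedges (wheel N)" if "v \<in> uverts (wheel N) - roots" for v
  proof -
    from that consider "v = Hub" | i j where "v = rim i j" "(i, j) \<in> slots" "0 < j"
      unfolding nonroots by blast
    then show ?thesis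
    proof cases
      case 1
      then show ?thesis using rim_range by (simp add: c Hub_edge_iff)
    next
      case 2
      then show ?thesis using rim_edge_iff[of i j] by (auto simp: c slots_def)
    qed
  qed
  moreover have "parent_of c v \<in> uverts (wheel N)" if "v \<in> uverts (wheel N) - roots" for v
    using uedges_ends(2)[OF fin_simple_ugraph_wheel[OF N] edge[OF that]] .
  moreover have "parent_of c \<in> extensional (uverts (wheel N) - roots)"
    by (simp add: c parent_of_def)
  moreover have "\<exists>h :: wheel_vertex \<Rightarrow> nat. \<forall>v\<in>uverts (wheel N) - roots. h (parent_of c v) < h v"
    using assms heightI unfolding c codes_iff by blast
  ultimately show ?thesis by (simp add: parent_maps_def PiE_iff)
qed

text \<open>The parent of the hub determines the slot, and the parents of interior rim vertices
  determine the letters because distinct moves have distinct targets.\<close>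

lemma parent_of_inj: "inj_on parent_of codes"
proof (rule inj_onI)
  fix c c' assume cc: "c \<in> codes" "c' \<in> codes" and eq: "parent_of c = parent_of c'"
  obtain i\<^sub>0 j\<^sub>0 w where c: "c = ((i\<^sub>0, j\<^sub>0), w)" by (metis prod.exhaust)
  obtain i\<^sub>1 j\<^sub>1 w' where c': "c' = ((i\<^sub>1, j\<^sub>1), w')" by (metis prod.exhaust)
  note cc = cc[unfolded c c' codes_iff]
  have "rim i\<^sub>0 j\<^sub>0 = rim i\<^sub>1 j\<^sub>1" using fun_cong[OF eq, of Hub] by (simp add: c c')
  then have "(i\<^sub>0, j\<^sub>0) = (i\<^sub>1, j\<^sub>1)" using rim_eq_iff cc by blast
  moreover have "w = w'"
  proof (rule extensionalityI[of _ "{1..r}"])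
    fix i assume i: "i \<in> {1..r}"
    show "w i = w' i"
    proof (rule nth_equalityI)
      show "length (w i) = length (w' i)" using cc i by (simp add: arc_words_def)
      fix n assume "n < length (w i)"
      then have s: "(i, Suc n) \<in> slots" using cc i by (auto simp: arc_words_def slots_def)
      then have "move_target i (Suc n) (w i ! n) = move_target i (Suc n) (w' i ! n)"
        using fun_cong[OF eq, of "rim i (Suc n)"] by (simp add: c c')
      then show "w i ! n = w' i ! n" using move_target_inj[OF i] by blast
    qed
  qed (use cc in auto)
  ultimately show "c = c'" by (simp add: c c')
qed

text \<open>Every neighbour of an interior rim vertex is the target of a move, so words can be read
  off from the parents; \<open>heightD\<close> shows that they form a code.\<close>

lemma parent_of_surj:
  assumes p: "p \<in> parent_maps (wheel N) roots"
  shows "p \<in> parent_of ` codes"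
proof -
  obtain h :: "wheel_vertex \<Rightarrow> nat" where ext: "p \<in> extensional (uverts (wheel N) - roots)"
    and edge: "\<And>v. v \<in> uverts (wheel N) - roots \<Longrightarrow> {v, p v} \<in> uedges (wheel N)"
    and h: "\<And>v. v \<in> uverts (wheel N) - roots \<Longrightarrow> h (p v) < h v"
    using p unfolding parent_maps_def PiE_def by blast
  have "p Hub \<in> case_prod rim ` slots"
    using edge[of Hub] by (simp add: nonroots Hub_edge_iff rim_covers)
  then obtain i\<^sub>0 j\<^sub>0 where k: "(i\<^sub>0, j\<^sub>0) \<in> slots" "p Hub = rim i\<^sub>0 j\<^sub>0" by auto
  have "\<exists>m. p (rim i j) = move_target i j m" if "(i, j) \<in> slots" "0 < j" for i j
  proof -
    have "rim i j \<in> uverts (wheel N) - roots" using that unfolding nonroots by blast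
    from edge[OF this] show ?thesis using rim_edge_iff[of i j] that by (auto simp: slots_def)
  qed
  then obtain m where m: "\<And>i j. (i, j) \<in> slots \<Longrightarrow> 0 < j \<Longrightarrow> p (rim i j) = move_target i j (m i j)"
    by metis
  \<comment> \<open>Only interior positions carry letters, and the restriction to
    \<open>{1..r}\<close> provides the extensionality that \<open>codes\<close> requires.\<close>
  define w where "w = (\<lambda>i\<in>{1..r}. map (m i) [1..<d i])"
  have len: "length (w i) = d i - 1" if "i \<in> {1..r}" for i using that by (simp add: w_def)
  have p_eq: "p = parent_of ((i\<^sub>0, j\<^sub>0), w)"
  proof (rule extensionalityI[OF ext])
    show "parent_of ((i\<^sub>0, j\<^sub>0), w) \<in> extensional (uverts (wheel N) - roots)"
      by (simp add: parent_of_def)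
    fix v assume "v \<in> uverts (wheel N) - roots"
    then consider "v = Hub" | i j where "v = rim i j" "(i, j) \<in> slots" "0 < j"
      unfolding nonroots by blast
    then show "p v = parent_of ((i\<^sub>0, j\<^sub>0), w) v"
    proof cases
      case 1
      then show ?thesis using k by simp
    next
      case 2
      then have "w i ! (j - 1) = m i j" by (auto simp: w_def slots_def)
      then show ?thesis using 2 m by simp
    qed
  qed
  have "((i\<^sub>0, j\<^sub>0), w) \<in> codes"
    unfolding codes_iff
    using k(1) heightD[of i\<^sub>0 j\<^sub>0 w h, OF k(1) len h[unfolded p_eq]] by (simp add: w_def)
  then show ?thesis using p_eq by blast
qed

text \<open>For a fixed slot the words on different arcs are independent, and only the arc of the
  hub's parent depends on the position. Summing over that position turns its factor into a Lucas
  number minus 2.\<close>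

lemma card_codes:
  "card codes = (\<Sum>i=1..r. (lucas (2 * d i) - 2) * (\<Prod>j\<in>{1..r} - {i}. fib (2 * d j)))"
proof -
  let ?f = "\<lambda>i. \<Prod>j\<in>{1..r} - {i}. fib (2 * d j)"
  let ?S = "\<lambda>i j i'. if i' = i then hub_words (d i' - 1) j else arc_words (d i' - 1)"
  have pos: "Suc (d i - 1) = d i" if "i \<in> {1..r}" for i using d_pos[OF that] by simp
  have fib: "card (arc_words (d i - 1)) = fib (2 * d i)" if "i \<in> {1..r}" for i
    using card_arc_words[of "d i - 1"] by (simp only: pos[OF that])
  have luc: "(\<Sum>j<d i. card (hub_words (d i - 1) j)) = lucas (2 * d i) - 2" if "i \<in> {1..r}" for i
    using sum_card_hub_words[of "d i - 1"] unfolding pos[OF that] by linarith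
  have fin: "finite (\<Pi>\<^sub>E i'\<in>{1..r}. ?S i j i')" for i j
    by (intro finite_PiE) (auto intro: finite_subset[OF hub_words_subset] finite_arc_words)
  have "card codes = (\<Sum>(i, j)\<in>slots. card (\<Pi>\<^sub>E i'\<in>{1..r}. ?S i j i'))"
    unfolding codes_def using fin by (subst card_SigmaI) (auto simp: slots_def split_def)
  also have "\<dots> = (\<Sum>i=1..r. \<Sum>j<d i. card (\<Pi>\<^sub>E i'\<in>{1..r}. ?S i j i'))"
    unfolding slots_def by (simp add: sum.Sigma)
  also have "\<dots> = (\<Sum>i=1..r. \<Sum>j<d i. card (hub_words (d i - 1) j) * ?f i)"
  proof (intro sum.cong refl)
    fix i j assume i: "i \<in> {1..r}"
    have "card (\<Pi>\<^sub>E i'\<in>{1..r}. ?S i j i') = (\<Prod>i'\<in>{1..r}. card (?S i j i'))"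
      by (simp add: card_PiE)
    also have "\<dots> = card (?S i j i) * (\<Prod>i'\<in>{1..r} - {i}. card (?S i j i'))"
      using i by (intro prod.remove) auto
    also have "(\<Prod>i'\<in>{1..r} - {i}. card (?S i j i')) = ?f i"
      by (intro prod.cong) (simp_all add: fib del: One_nat_def)
    finally show "card (\<Pi>\<^sub>E i'\<in>{1..r}. ?S i j i') = card (hub_words (d i - 1) j) * ?f i" by simp
  qed
  also have "\<dots> = (\<Sum>i=1..r. (lucas (2 * d i) - 2) * ?f i)"
    by (intro sum.cong) (simp_all add: luc del: One_nat_def flip: sum_distrib_right)
  finally show ?thesis .
qed

lemma num_rooted_forests_wheel:
  "num_rooted_forests (wheel N) roots =
     (\<Sum>i=1..r. (lucas (2 * d i) - 2) * (\<Prod>j\<in>{1..r} - {i}. fib (2 * d j)))"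
proof -
  have "roots \<subseteq> uverts (wheel N)"
    using rim_range by (auto simp: roots_eq verts_wheel)
  then have "num_rooted_forests (wheel N) roots = card (parent_maps (wheel N) roots)"
    by (rule num_rooted_forests_eq_card_parent_maps[OF fin_simple_ugraph_wheel[OF N]])
  also have "\<dots> = card codes"
    using parent_of_in_parent_maps parent_of_surj
    by (intro bij_betw_same_card[symmetric, of parent_of] bij_betw_imageI[OF parent_of_inj]) blast
  finally show ?thesis by (simp only: card_codes)
qed

text \<open>Makes the natural-number subtraction in the count agree with the real one in the
  theorem.\<close>

lemma lucas_ge_2: "2 \<le> lucas (2 * d i)" if "i \<in> {1..r}"
proof -
  have "Suc (d i - 1) = d i" using d_pos[OF that] by simp
  then show ?thesis using sum_card_hub_words[of "d i - 1"] by simp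
qed

end

theorem theorem1p1:
  fixes N r :: nat and a d :: "nat \<Rightarrow> nat" and R :: "wheel_vertex set"
  assumes "3 \<le> N" and "1 \<le> r" and "r \<le> N"
    and "1 \<le> a 1" and "strict_mono_on {1..r} a" and "a r \<le> N"
    and "R = {Rim (a i) | i. i \<in> {1..r}}"
    and "\<And>i. 1 \<le> i \<Longrightarrow> i \<le> r - 1 \<Longrightarrow> d i = a (i + 1) - a i"
    and "d r = a 1 + N - a r"
  shows "real (num_rooted_forests (wheel N) R) =
           (\<Prod>i=1..r. real (fib (2 * d i))) *
           (\<Sum>i=1..r. (real (lucas (2 * d i)) - 2) / real (fib (2 * d i)))
       \<and> (\<Prod>i=1..r. real (fib (2 * d i))) *
           (\<Sum>i=1..r. (real (lucas (2 * d i)) - 2) / real (fib (2 * d i))) =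
           (\<Sum>i=1..r. (real (lucas (2 * d i)) - 2) *
              (\<Prod>j\<in>{1..r} - {i}. real (fib (2 * d j))))"
proof -
  interpret rooted_wheel N r a d
    using assms by unfold_locales
  let ?F = "\<lambda>i. real (fib (2 * d i))" and ?L = "\<lambda>i. real (lucas (2 * d i)) - 2"
  have "real (num_rooted_forests (wheel N) R) = (\<Sum>i=1..r. ?L i * (\<Prod>j\<in>{1..r} - {i}. ?F j))"
    unfolding assms(7) roots_def[symmetric] num_rooted_forests_wheel of_nat_sum
    by (intro sum.cong refl) (simp add: of_nat_diff lucas_ge_2)
  moreover have "(\<Prod>i=1..r. ?F i) * (\<Sum>i=1..r. ?L i / ?F i) =
      (\<Sum>i=1..r. ?L i * (\<Prod>j\<in>{1..r} - {i}. ?F j))"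
    unfolding sum_distrib_left
  proof (intro sum.cong refl)
    fix i assume i: "i \<in> {1..r}"
    \<comment> \<open>Arcs have positive length, so the quotients divide by nonzero Fibonacci
      numbers and the factor cancels.\<close>
    have "?F i \<noteq> 0" using d_pos[OF i] fib_neq_0_nat[of "2 * d i"] by simp
    moreover have "(\<Prod>i=1..r. ?F i) = ?F i * (\<Prod>j\<in>{1..r} - {i}. ?F j)"
      using i by (intro prod.remove) auto
    ultimately show "(\<Prod>i=1..r. ?F i) * (?L i / ?F i) = ?L i * (\<Prod>j\<in>{1..r} - {i}. ?F j)"
      by simp
  qed
  ultimately show ?thesis by simp
qed

end
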